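(* Consider the time-dependent multi-agent optimization problem (MAOP) with data $n$, $T>0$, $I=[0,T]$, $q\in(0,1]$, $K_j$, $\Theta_j$, $f_j$, $g_j$, $x_{0j}$, $a_j$ ($1\le j\le n$) described in the context, and let $f,g,G,K$ be the associated maps defined there. Assume: (1) there are constants $l_G,\eta_G>0$ such that $\|G(s_2,x_2,u_2)-G(s_1,x_1,u_1)\|\le l_G(|s_2-s_1|+\|x_2-x_1\|+\|u_2-u_1\|)$ for all $s_1,s_2\in I$, $x_1,x_2,u_1,u_2\in R^n$, and, for all $s\in I$, $x,u\in R^n$ and $u_1,u_2\in K(u)$, $\langle G(s,x,u_2),u_1-u_2\rangle\ge 0$ implies $\langle G(s,x,u_1),u_1-u_2\rangle\ge\eta_G\|u_1-u_2\|^2$; (2) there is $l_K\ge 0$ such that $\|P_{K(u_2)}[\varpi]-P_{K(u_1)}[\varpi]\|\le l_K\|u_2-u_1\|$ for all $u_1,u_2,\varpi\in R^n$; (3) $g$ is continuous and there is $l_g>0$ with $\|g(s,x_2,u_2)-g(s,x_1,u_1)\|\le l_g(\|x_2-x_1\|+\|u_2-u_1\|)$ for all $s\in I$, $x_1,x_2,u_1,u_2\in R^n$; (4) $f$ is continuous and there is $l_f>0$ with $\|f(s,x_2)-f(s,x_1)\|\le l_f\|x_2-x_1\|$ for all $s\in I$, $x_1,x_2\in R^n$; (5) $2\dfrac{l_K^2}{\eta_G^2}\left(l_G\sqrt{4l_G^2+2\eta_G^2}+2l_G^2+\eta_G^2\right)<1$; (6) $0<\max_{j=1,\dots,n}|a_j|<1$.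 Then there exists $c>0$ such that for any $\varepsilon>0$ the optimal state $x^*$ of the MAOP satisfies $$\|z^*(s)-x^*(s)\|\le c\,\varepsilon\,\mathrm{E}_q(s)\quad\text{for all } s\in I,$$ where $(z^*,\upsilon^* )\in C(I,R^n)\times C(I,R^n)$ is any solution of the inequality system $$\begin{cases}\left\|{}^{C}_{0}\mathrm{D}_s^{q}z^*(s)-f(s,z^*(s))-g(s,z^*(s),\upsilon^*(s))\right\|\le\varepsilon, & s\in I,\\ \langle G(s,z^*(s),\upsilon^*(s)),w-\upsilon^*(s)\rangle\ge 0\ \ \forall w\in K(\upsilon^*(s)), & s\in I,\\ z^*(0)=x^*(0).\end{cases}$$
   Context: There are $n$ agents. For agent $j$ ($1\le j\le n$), $x_j(s)\in R$ is the state and $u_j(s)\in R$ the strategy at time $s\in I$; write $x=(x_1,\dots,x_n)^\top=(x_j,x_{-j})$ and $u=(u_1,\dots,u_n)^\top=(u_j,u_{-j})$, where $u_{-j}\in R^{n-1}$ omits the $j$-th component (similarly $x_{-j}$). $K_j:R^{n-1}\to 2^{R}$ is set-valued with nonempty closed convex values; $\Theta_j:R^n\times R^n\to R$, written $\Theta_j(x,u)=\Theta_j(x_j,x_{-j},u_j,u_{-j})$, is agent $j$'s cost function, convex and continuously differentiable with respect to $u_j$; $f_j:I\times R\to R$, $g_j:I\times R\times R\to R$; $x_{0j},a_j\in R$. The MAOP is: for every $j$ and every $s\in I$, $$\min_{u_j(s)\in K_j(u^*_{-j}(s))}\Theta_j(x_j(s),x^*_{-j}(s),u_j(s),u^*_{-j}(s))$$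 subject to ${}^{C}_{0}\mathrm{D}^q_s x_j(s)=f_j(s,x_j(s))+g_j(s,x_j(s),u_j(s))$ and $x_j(0)=x_{0j}+a_j\frac{1}{T}\int_0^T x_j(\zeta)\,d\zeta$, where ${}^{C}_{0}\mathrm{D}^q_s$ is the Caputo derivative. A general Nash equilibrium (solution, optimal pair; $x^*$ is then the optimal state) is a pair $(x^*,u^* )\in C(I,R^n)\times C(I,R^n)$ such that for each $j$: (i) for all $s\in I$, $x_j^*(s)=x_{0j}+\frac{a_j}{T}\int_0^T x_j^*(\zeta)\,d\zeta+\frac{1}{\Gamma(q)}\int_0^s(s-\zeta)^{q-1}[f_j(\zeta,x_j^*(\zeta))+g_j(\zeta,x_j^*(\zeta),u_j^*(\zeta))]\,d\zeta$ (the integral form of the state equation); (ii) for all $s\in I$, $u_j^*(s)\in K_j(u_{-j}^*(s))$ and $u_j^*(s)$ minimizes $w\mapsto\Theta_j(x_j^*(s),x_{-j}^*(s),w,u_{-j}^*(s))$ over $w\in K_j(u^*_{-j}(s))$. Associated maps: $f(s,y)=(f_1(s,y_1),\dots,f_n(s,y_n))^\top$, $g(s,y,v)=(g_1(s,y_1,v_1),\dots,g_n(s,y_n,v_n))^\top$, $G(s,y,v)=\left(\nabla_{v_1}\Theta_1(y,v),\dots,\nabla_{v_n}\Theta_n(y,v)\right)$, $K(v)=\prod_{j=1}^nK_j(v_{-j})$ for $s\in I$, $y,v\in R^n$. $P_C$ is the metric projection onto the nonempty closed convex set $C$. $\mathrm{E}_q(t)=\sum_{n=0}^\infty\frac{t^n}{\Gamma(nq+1)}$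 is the Mittag-Leffler function. In the inequality system the second line includes $\upsilon^*(s)\in K(\upsilon^*(s))$. A pair $(z^*,\upsilon^* )$ satisfies the inequality system iff, besides the second and third lines, there is $h\in C(I,R^n)$ with $\|h(s)\|\le\varepsilon$ on $I$ and $z^*(s)=z^*(0)+\frac{1}{\Gamma(q)}\int_0^s(s-\zeta)^{q-1}[f(\zeta,z^*(\zeta))+g(\zeta,z^*(\zeta),\upsilon^*(\zeta))+h(\zeta)]\,d\zeta$ for all $s\in I$. *)

theory Defs
  imports "HOL-Analysis.Analysis"
begin

(* The points u_{-j} of R^(n-1) are represented as functions that are undefined at j,
   so that a map of others j v cannot depend on the j-th component of v. *)
definition others :: "'n \<Rightarrow> real ^ 'n \<Rightarrow> ('n \<Rightarrow> real)" where
  "others j v = restrict (\<lambda>i. v $ i) (- {j})"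

(* (w, v_{-j}): the vector v with its j-th component replaced by w. *)
definition subst_comp :: "real ^ 'n \<Rightarrow> 'n \<Rightarrow> real \<Rightarrow> real ^ 'n" where
  "subst_comp v j w = (\<chi> i. if i = j then w else v $ i)"

definition f_vec :: "('n \<Rightarrow> real \<Rightarrow> real \<Rightarrow> real) \<Rightarrow> real \<Rightarrow> real ^ 'n \<Rightarrow> real ^ 'n" where
  "f_vec f s y = (\<chi> j. f j s (y $ j))"

definition g_vec ::
    "('n \<Rightarrow> real \<Rightarrow> real \<Rightarrow> real \<Rightarrow> real) \<Rightarrow> real \<Rightarrow> real ^ 'n \<Rightarrow> real ^ 'n \<Rightarrow> real ^ 'n" where
  "g_vec g s y v = (\<chi> j. g j s (y $ j) (v $ j))"

(* The pseudo-gradient: component j is the partial derivative of the cost of agent j with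
   respect to that agent's own strategy v_j. It is constant in the time argument s. *)
definition G_map ::
    "('n \<Rightarrow> real ^ 'n \<Rightarrow> real ^ 'n \<Rightarrow> real) \<Rightarrow> real \<Rightarrow> real ^ 'n \<Rightarrow> real ^ 'n \<Rightarrow> real ^ 'n" where
  "G_map \<Theta> s y v = (\<chi> j. deriv (\<lambda>w. \<Theta> j y (subst_comp v j w)) (v $ j))"

definition K_map :: "('n \<Rightarrow> ('n \<Rightarrow> real) \<Rightarrow> real set) \<Rightarrow> real ^ 'n \<Rightarrow> (real ^ 'n) set" where
  "K_map K v = {w. \<forall>j. w $ j \<in> K j (others j v)}"

(* Riemann-Liouville integral of order q based at 0. *)
definition frac_integral :: "real \<Rightarrow> (real \<Rightarrow> 'a::banach) \<Rightarrow> real \<Rightarrow> 'a" where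
  "frac_integral q h s =
     (1 / Gamma q) *\<^sub>R integral {0..s} (\<lambda>\<zeta>. (s - \<zeta>) powr (q - 1) *\<^sub>R h \<zeta>)"

definition mittag_leffler :: "real \<Rightarrow> real \<Rightarrow> real" where
  "mittag_leffler q t = (\<Sum>k. t ^ k / Gamma (real k * q + 1))"

(* General Nash equilibrium of the MAOP; the state equation with its nonlocal initial
   condition is taken in integral form. *)
definition nash_equilibrium ::
    "real \<Rightarrow> real \<Rightarrow> ('n::finite \<Rightarrow> ('n \<Rightarrow> real) \<Rightarrow> real set)
     \<Rightarrow> ('n \<Rightarrow> real ^ 'n \<Rightarrow> real ^ 'n \<Rightarrow> real)
     \<Rightarrow> ('n \<Rightarrow> real \<Rightarrow> real \<Rightarrow> real) \<Rightarrow> ('n \<Rightarrow> real \<Rightarrow> real \<Rightarrow> real \<Rightarrow> real)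
     \<Rightarrow> ('n \<Rightarrow> real) \<Rightarrow> ('n \<Rightarrow> real) \<Rightarrow> (real \<Rightarrow> real ^ 'n) \<Rightarrow> (real \<Rightarrow> real ^ 'n) \<Rightarrow> bool" where
  "nash_equilibrium T q K \<Theta> f g x0 a x u \<longleftrightarrow>
     continuous_on {0..T} x \<and> continuous_on {0..T} u \<and>
     (\<forall>j.
       (\<forall>s\<in>{0..T}. x s $ j =
          x0 j + a j / T * integral {0..T} (\<lambda>\<zeta>. x \<zeta> $ j)
          + frac_integral q (\<lambda>\<zeta>. f j \<zeta> (x \<zeta> $ j) + g j \<zeta> (x \<zeta> $ j) (u \<zeta> $ j)) s) \<and>
       (\<forall>s\<in>{0..T}. u s $ j \<in> K j (others j (u s)) \<and>
          (\<forall>w\<in>K j (others j (u s)). \<Theta> j (x s) (u s) \<le> \<Theta> j (x s) (subst_comp (u s) j w))))"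

(* The inequality system without its initial condition. The bound on the Caputo derivative
   is taken in integral form, with a continuous perturbation h. *)
definition perturbed_solution ::
    "real \<Rightarrow> real \<Rightarrow> ('n::finite \<Rightarrow> ('n \<Rightarrow> real) \<Rightarrow> real set)
     \<Rightarrow> ('n \<Rightarrow> real ^ 'n \<Rightarrow> real ^ 'n \<Rightarrow> real)
     \<Rightarrow> ('n \<Rightarrow> real \<Rightarrow> real \<Rightarrow> real) \<Rightarrow> ('n \<Rightarrow> real \<Rightarrow> real \<Rightarrow> real \<Rightarrow> real)
     \<Rightarrow> real \<Rightarrow> (real \<Rightarrow> real ^ 'n) \<Rightarrow> (real \<Rightarrow> real ^ 'n) \<Rightarrow> bool" where
  "perturbed_solution T q K \<Theta> f g \<epsilon> z \<upsilon> \<longleftrightarrow>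
     continuous_on {0..T} z \<and> continuous_on {0..T} \<upsilon> \<and>
     (\<exists>h. continuous_on {0..T} h \<and> (\<forall>s\<in>{0..T}. norm (h s) \<le> \<epsilon>) \<and>
        (\<forall>s\<in>{0..T}. z s = z 0 +
           frac_integral q (\<lambda>\<zeta>. f_vec f \<zeta> (z \<zeta>) + g_vec g \<zeta> (z \<zeta>) (\<upsilon> \<zeta>) + h \<zeta>) s)) \<and>
     (\<forall>s\<in>{0..T}. \<upsilon> s \<in> K_map K (\<upsilon> s) \<and>
        (\<forall>w\<in>K_map K (\<upsilon> s). G_map \<Theta> s (z s) (\<upsilon> s) \<bullet> (w - \<upsilon> s) \<ge> 0))"

end

theory Submission
  imports Defs
begin

text \<open>
  The perturbed solution stays within a constant times \<open>\<epsilon>\<close> of the optimal state, and the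
  Mittag-Leffler function is at least \<open>1\<close> on the nonnegative half-line because its constant term
  is \<open>1\<close> and no term is negative (\<open>mittag_leffler_ge_1\<close>). Hence a bound
  \<open>norm (z s - x s) \<le> c * \<epsilon>\<close> suffices, provided that \<open>c\<close> depends on the data of the problem only.

  Two estimates give this bound. The first one compares strategies at a fixed time. By the
  first-order optimality condition of every agent, a Nash equilibrium strategy solves a
  quasi-variational inequality for the pseudo-gradient whose parameter is the state \<open>x s\<close>; the
  perturbed strategy solves the same one with the parameter \<open>z s\<close>. Such solutions depend on the
  parameter in a Lipschitz way (\<open>quasi_variational_dependence\<close>). To see this, take a projection step
  from the solution \<open>u\<close> of one problem to the constraint set of the other problem, whose solution
  is \<open>v\<close>. The resulting point \<open>p\<close> is close to \<open>u\<close>, since the two projections of one point are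
  close and \<open>u\<close> is a fixed point of its own projection step. Moreover \<open>p\<close> is admissible for the
  problem solved by \<open>v\<close>, so that strong pseudomonotonicity bounds its distance to \<open>v\<close>. The feedback of the constraint sets on the
  strategies enters with the factor \<open>l_K * (sqrt 2 + l_G / \<eta>_G)\<close>, and the contraction hypothesis
  makes it smaller than \<open>1\<close> (\<open>quasi_variational_constant_less_1\<close>).

  The second estimate is in time. The nonlocal term of the state equation is constant in time, so
  with equal initial values \<open>z - x\<close> is the fractional integral of a difference of
  right-hand sides, which by the first estimate is at most \<open>\<mu> * norm (z - x) + \<epsilon>\<close>. The
  fractional integral of \<open>exp (\<beta> * s)\<close> is at most \<open>exp (\<beta> * s) / \<beta> powr q\<close>, so for large \<open>\<beta>\<close> it is
  a contraction in the sup norm with weight \<open>exp (- \<beta> * s)\<close>. The choice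
  \<open>\<beta> powr q = \<mu> + 1\<close> yields \<open>norm (z s - x s) \<le> \<epsilon> * exp (\<beta> * s)\<close> (\<open>fractional_gronwall\<close>), and
  \<open>c = exp (\<beta> * T)\<close> works.
\<close>

section \<open>Variational inequalities with moving constraint sets\<close>

text \<open>
  The minimum may lie on the boundary of \<open>S\<close> and need not be a critical point. The sign of the
  derivative comes from moving slightly towards \<open>w\<close>, which stays in \<open>S\<close> by convexity.
\<close>

lemma real_minimizer_first_order:
  fixes \<phi> :: "real \<Rightarrow> real"
  assumes deriv: "(\<phi> has_real_derivative D) (at u)"
    and "convex S" "u \<in> S" "w \<in> S"
    and min: "\<And>y. y \<in> S \<Longrightarrow> \<phi> u \<le> \<phi> y"
  shows "D * (w - u) \<ge> 0"
proof (rule ccontr)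
  assume neg: "\<not> ?thesis"
  have "((\<lambda>t. \<phi> (u + t * (w - u))) has_real_derivative D * (w - u)) (at 0)"
    by (rule DERIV_chain2[where f = \<phi>]) (use deriv in \<open>auto intro!: derivative_eq_intros\<close>)
  from DERIV_neg_dec_right[OF this] neg obtain d where "d > 0"
    and d: "\<And>h. 0 < h \<Longrightarrow> h < d \<Longrightarrow> \<phi> (u + h * (w - u)) < \<phi> u"
    by auto
  define h where "h = min (d / 2) 1"
  have h: "0 < h" "h < d" "h \<le> 1"
    using \<open>d > 0\<close> by (auto simp: h_def)
  have "(1 - h) *\<^sub>R u + h *\<^sub>R w \<in> S"
    using assms h by (intro convexD) auto
  also have "(1 - h) *\<^sub>R u + h *\<^sub>R w = u + h * (w - u)"
    by (simp add: algebra_simps)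
  finally show False
    using min d[OF h(1,2)] by force
qed

text \<open>
  The converse of \<open>closest_point_dot\<close>, which lets a solution of a variational inequality be read
  as a fixed point of its projection step.
\<close>

lemma closest_point_eqI_obtuse:
  fixes S :: "'a::euclidean_space set"
  assumes "convex S" "closed S" "u \<in> S" and obtuse: "\<And>w. w \<in> S \<Longrightarrow> (b - u) \<bullet> (w - u) \<le> 0"
  shows "closest_point S b = u"
proof -
  let ?c = "closest_point S b"
  have "?c \<in> S"
    using assms by (intro closest_point_in_set) auto
  then have "(b - u) \<bullet> (?c - u) \<le> 0" "(b - ?c) \<bullet> (u - ?c) \<le> 0"
    using assms by (auto intro: closest_point_dot)
  then have "(u - ?c) \<bullet> (u - ?c) \<le> 0"
    by (simp add: algebra_simps inner_commute)
  then have "u - ?c = 0"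
    by (metis inner_eq_zero_iff inner_ge_zero order_antisym)
  then show ?thesis
    by simp
qed

text \<open>
  Both the map and the constraint set change between the two problems. The bridge is the point \<open>p\<close>
  of \<open>C\<^sub>2\<close> obtained from \<open>u\<close> by a projection step of length \<open>1 / r\<close>. Its distance to \<open>u\<close> is at most
  \<open>\<kappa>\<close>, and its projection property replaces the inequality for \<open>u\<close>, which cannot be tested at
  \<open>v\<close> because \<open>v\<close> need not lie in \<open>C\<^sub>1\<close>: it makes \<open>F\<^sub>1 u \<bullet> (p - v)\<close> at most
  \<open>r * \<kappa> * norm (p - v)\<close>. Long steps, that is small \<open>r\<close>, improve the bound.
\<close>

lemma variational_inequality_dependence:
  fixes u v :: "'a::euclidean_space" and F\<^sub>1 F\<^sub>2 :: "'a \<Rightarrow> 'a"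
  assumes C\<^sub>1: "convex C\<^sub>1" "closed C\<^sub>1" and C\<^sub>2: "convex C\<^sub>2" "closed C\<^sub>2"
    and u: "u \<in> C\<^sub>1" "\<And>w. w \<in> C\<^sub>1 \<Longrightarrow> F\<^sub>1 u \<bullet> (w - u) \<ge> 0"
    and v: "v \<in> C\<^sub>2" "\<And>w. w \<in> C\<^sub>2 \<Longrightarrow> F\<^sub>2 v \<bullet> (w - v) \<ge> 0"
    and pseudomonotone: "\<And>p. p \<in> C\<^sub>2 \<Longrightarrow> F\<^sub>2 v \<bullet> (p - v) \<ge> 0 \<Longrightarrow>
      F\<^sub>2 p \<bullet> (p - v) \<ge> \<eta> * (norm (p - v))\<^sup>2"
    and lipschitz: "\<And>p. norm (F\<^sub>2 p - F\<^sub>1 u) \<le> l * (d + norm (p - u))"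
    and distance: "\<And>b. norm (closest_point C\<^sub>2 b - closest_point C\<^sub>1 b) \<le> \<kappa>"
    and pos: "\<eta> > 0" "l \<ge> 0" "r > 0"
  shows "norm (u - v) \<le> \<kappa> + (l * d + (l + r) * \<kappa>) / \<eta>"
proof -
  define b where "b = u - (1 / r) *\<^sub>R F\<^sub>1 u"
  define p where "p = closest_point C\<^sub>2 b"
  have "(b - u) \<bullet> (w - u) \<le> 0" if "w \<in> C\<^sub>1" for w
    using u(2)[OF that] \<open>r > 0\<close> by (simp add: b_def)
  then have "closest_point C\<^sub>1 b = u"
    by (intro closest_point_eqI_obtuse C\<^sub>1 u(1))
  with distance[of b] have pu: "norm (p - u) \<le> \<kappa>"
    by (simp add: p_def)
  have "p \<in> C\<^sub>2"
    unfolding p_def using C\<^sub>2 v(1) by (intro closest_point_in_set) auto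
  have "(b - p) \<bullet> (v - p) \<le> 0"
    unfolding p_def by (intro closest_point_dot C\<^sub>2 v(1))
  then have "F\<^sub>1 u \<bullet> (p - v) / r \<le> (u - p) \<bullet> (p - v)"
    by (simp add: b_def algebra_simps inner_commute diff_divide_distrib)
  also have "\<dots> \<le> norm (u - p) * norm (p - v)"
    by (rule norm_cauchy_schwarz)
  also have "\<dots> \<le> \<kappa> * norm (p - v)"
    using pu by (intro mult_right_mono) (auto simp: norm_minus_commute)
  finally have F1: "F\<^sub>1 u \<bullet> (p - v) \<le> r * \<kappa> * norm (p - v)"
    using \<open>r > 0\<close> by (simp add: field_simps)
  have "(F\<^sub>2 p - F\<^sub>1 u) \<bullet> (p - v) \<le> norm (F\<^sub>2 p - F\<^sub>1 u) * norm (p - v)"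
    by (rule norm_cauchy_schwarz)
  also have "\<dots> \<le> l * (d + \<kappa>) * norm (p - v)"
    using pu pos by (intro mult_right_mono order_trans[OF lipschitz] mult_left_mono) auto
  finally have F2: "(F\<^sub>2 p - F\<^sub>1 u) \<bullet> (p - v) \<le> l * (d + \<kappa>) * norm (p - v)" .
  have "\<eta> * (norm (p - v))\<^sup>2 \<le> F\<^sub>2 p \<bullet> (p - v)"
    by (intro pseudomonotone v(2) \<open>p \<in> C\<^sub>2\<close>)
  also have "\<dots> = (F\<^sub>2 p - F\<^sub>1 u) \<bullet> (p - v) + F\<^sub>1 u \<bullet> (p - v)"
    by (simp add: inner_diff_left)
  also have "\<dots> \<le> (l * d + (l + r) * \<kappa>) * norm (p - v)"
    using F1 F2 by (simp add: algebra_simps)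
  finally have *: "\<eta> * norm (p - v) * norm (p - v) \<le> (l * d + (l + r) * \<kappa>) * norm (p - v)"
    by (simp add: power2_eq_square algebra_simps)
  \<comment> \<open>Nonnegativity of the right-hand side settles the degenerate case \<open>p = v\<close>, where the factor
    \<open>norm (p - v)\<close> cannot be cancelled.\<close>
  have "\<kappa> \<ge> 0"
    using pu norm_ge_zero order_trans by blast
  have "0 \<le> l * (d + norm (u - u))"
    using lipschitz[of u] norm_ge_zero order_trans by blast
  with \<open>\<kappa> \<ge> 0\<close> pos have "l * d + (l + r) * \<kappa> \<ge> 0"
    by simp
  with * have "\<eta> * norm (p - v) \<le> l * d + (l + r) * \<kappa>"
    by (cases "p = v") auto
  then have "norm (p - v) \<le> (l * d + (l + r) * \<kappa>) / \<eta>"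
    using pos by (simp add: field_simps)
  moreover have "norm (u - v) \<le> norm (p - u) + norm (p - v)"
    using dist_triangle2[of u v p] by (simp add: dist_norm norm_minus_commute)
  ultimately show ?thesis
    using pu by linarith
qed

text \<open>
  After multiplication by \<open>\<eta>_G\<^sup>2\<close> the claim is that the square \<open>(sqrt 2 * \<eta>_G + l_G)\<^sup>2\<close> lies below
  the bracket of the hypothesis: its mixed term is dominated since \<open>sqrt 2 * \<eta>_G\<close> is at most the
  square root there, and \<open>2 * \<eta>_G\<^sup>2\<close> occurs on both sides. So \<open>sqrt 2\<close> is the largest coefficient
  of \<open>\<eta>_G\<close> that this comparison permits.
\<close>

lemma quasi_variational_constant_less_1:
  fixes l_G \<eta>_G l_K :: real
  assumes "l_G > 0" "\<eta>_G > 0" "l_K \<ge> 0"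
    and "2 * (l_K\<^sup>2 / \<eta>_G\<^sup>2) *
      (l_G * sqrt (4 * l_G\<^sup>2 + 2 * \<eta>_G\<^sup>2) + 2 * l_G\<^sup>2 + \<eta>_G\<^sup>2) < 1"
  shows "l_K * (sqrt 2 + l_G / \<eta>_G) < 1"
proof -
  define P where "P = l_G * (sqrt 2 * \<eta>_G)"
  define Q where "Q = l_G * sqrt (4 * l_G\<^sup>2 + 2 * \<eta>_G\<^sup>2)"
  have "sqrt 2 * \<eta>_G = sqrt (2 * \<eta>_G\<^sup>2)"
    using assms by (simp add: real_sqrt_mult)
  also have "\<dots> \<le> sqrt (4 * l_G\<^sup>2 + 2 * \<eta>_G\<^sup>2)"
    by simp
  finally have "P \<le> Q"
    unfolding P_def Q_def using assms by (intro mult_left_mono) auto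
  moreover have "(sqrt 2 * \<eta>_G + l_G)\<^sup>2 = 2 * \<eta>_G\<^sup>2 + l_G\<^sup>2 + 2 * P"
    by (simp add: P_def power2_sum power_mult_distrib)
  moreover have "0 \<le> 3 * l_G\<^sup>2"
    by simp
  ultimately have "(sqrt 2 * \<eta>_G + l_G)\<^sup>2 \<le> 2 * (Q + 2 * l_G\<^sup>2 + \<eta>_G\<^sup>2)"
    by argo
  then have "(l_K\<^sup>2 / \<eta>_G\<^sup>2) * (sqrt 2 * \<eta>_G + l_G)\<^sup>2
      \<le> (l_K\<^sup>2 / \<eta>_G\<^sup>2) * (2 * (Q + 2 * l_G\<^sup>2 + \<eta>_G\<^sup>2))"
    by (intro mult_left_mono) auto
  also have "\<dots> = 2 * (l_K\<^sup>2 / \<eta>_G\<^sup>2) * (Q + 2 * l_G\<^sup>2 + \<eta>_G\<^sup>2)"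
    by (simp only: mult_ac)
  also have "\<dots> < 1"
    using assms(4) by (simp only: Q_def)
  also have "(l_K\<^sup>2 / \<eta>_G\<^sup>2) * (sqrt 2 * \<eta>_G + l_G)\<^sup>2 = (l_K * (sqrt 2 + l_G / \<eta>_G))\<^sup>2"
    using assms by (simp add: power_mult_distrib[symmetric] power_divide[symmetric]) (simp add: field_simps)
  finally show ?thesis
    by (simp add: abs_square_less_1)
qed

text \<open>
  In a quasi-variational inequality the constraint set depends on the solution, so the distance
  \<open>\<kappa>\<close> between the projections is at most \<open>l_K * norm (v - u)\<close> and contains the quantity to be
  estimated. Its total coefficient is smaller than \<open>1\<close>, so it can be absorbed on the left.
\<close>

lemma quasi_variational_dependence:
  fixes S :: "'a::euclidean_space \<Rightarrow> 'a set" and G :: "'b::real_normed_vector \<Rightarrow> 'a \<Rightarrow> 'a"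
  assumes S_values: "\<And>v. closed (S v)" "\<And>v. convex (S v)"
    and constants: "l_G > 0" "\<eta>_G > 0" "l_K \<ge> 0"
    and G_lipschitz: "\<And>x1 x2 u1 u2.
      norm (G x2 u2 - G x1 u1) \<le> l_G * (norm (x2 - x1) + norm (u2 - u1))"
    and G_pseudomonotone: "\<And>x u u1 u2. u1 \<in> S u \<Longrightarrow> u2 \<in> S u \<Longrightarrow>
      G x u2 \<bullet> (u1 - u2) \<ge> 0 \<Longrightarrow> G x u1 \<bullet> (u1 - u2) \<ge> \<eta>_G * (norm (u1 - u2))\<^sup>2"
    and S_lipschitz: "\<And>u1 u2 p.
      norm (closest_point (S u2) p - closest_point (S u1) p) \<le> l_K * norm (u2 - u1)"
    and contraction: "l_K * (sqrt 2 + l_G / \<eta>_G) < 1"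
    and u: "u \<in> S u" "\<And>w. w \<in> S u \<Longrightarrow> G x u \<bullet> (w - u) \<ge> 0"
    and v: "v \<in> S v" "\<And>w. w \<in> S v \<Longrightarrow> G z v \<bullet> (w - v) \<ge> 0"
  shows "norm (v - u) \<le> l_G / \<eta>_G / (1 - l_K * (sqrt 2 + l_G / \<eta>_G)) * norm (z - x)"
proof -
  let ?\<kappa> = "l_K * norm (v - u)"
  have "norm (u - v) \<le> ?\<kappa> + (l_G * norm (z - x) + (l_G + (sqrt 2 - 1) * \<eta>_G) * ?\<kappa>) / \<eta>_G"
    \<comment> \<open>The choice \<open>r = (sqrt 2 - 1) * \<eta>_G\<close> makes \<open>l_K * (sqrt 2 + l_G / \<eta>_G)\<close> the total coefficient
      of \<open>norm (v - u)\<close> on the right.\<close>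
  proof (rule variational_inequality_dependence)
    show "norm (G z p - G x u) \<le> l_G * (norm (z - x) + norm (p - u))" for p
      by (rule G_lipschitz)
    show "\<eta>_G * (norm (p - v))\<^sup>2 \<le> G z p \<bullet> (p - v)" if "p \<in> S v" "0 \<le> G z v \<bullet> (p - v)" for p
      using that v(1) G_pseudomonotone by blast
  qed (use S_values constants S_lipschitz u v in auto)
  also have "\<dots> = l_G / \<eta>_G * norm (z - x) + l_K * (sqrt 2 + l_G / \<eta>_G) * norm (v - u)"
    using constants by (simp add: field_simps)
  finally have "norm (v - u) * (1 - l_K * (sqrt 2 + l_G / \<eta>_G)) \<le> l_G / \<eta>_G * norm (z - x)"
    by (simp add: norm_minus_commute algebra_simps)
  moreover have "1 - l_K * (sqrt 2 + l_G / \<eta>_G) > 0"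
    using contraction by simp
  ultimately have "norm (v - u) \<le> l_G / \<eta>_G * norm (z - x) / (1 - l_K * (sqrt 2 + l_G / \<eta>_G))"
    by (subst pos_le_divide_eq)
  then show ?thesis
    by simp
qed

section \<open>A Gronwall inequality for fractional integrals\<close>

text \<open>
  The kernel is unbounded at \<open>\<zeta> = s\<close> when \<open>q < 1\<close>, but it is absolutely integrable, and a continuous
  function on a compact interval is a bounded measurable factor.
\<close>

lemma integrable_frac_kernel:
  fixes h :: "real \<Rightarrow> 'a::euclidean_space"
  assumes "q > 0" "s \<ge> 0" "continuous_on {0..s} h"
  shows "(\<lambda>\<zeta>. (s - \<zeta>) powr (q - 1) *\<^sub>R h \<zeta>) integrable_on {0..s}"
proof -
  have "(\<lambda>t. t powr (q - 1)) integrable_on {0..s}"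
    using has_integral_powr_from_0[of "q - 1" s] assms by (auto simp: integrable_on_def)
  then have "((\<lambda>t. t powr (q - 1)) has_integral integral {0..s} (\<lambda>t. t powr (q - 1))) (cbox 0 s)"
    by (simp add: integrable_integral)
  from has_integral_affinity[OF this, of "-1" s] 
  have "(\<lambda>\<zeta>. (s - \<zeta>) powr (q - 1)) integrable_on {0..s}"
    using assms by (auto simp: integrable_on_def)
  then have kernel: "(\<lambda>\<zeta>. (s - \<zeta>) powr (q - 1)) absolutely_integrable_on {0..s}"
    by (intro nonnegative_absolutely_integrable_1) auto
  have "(\<lambda>\<zeta>. (s - \<zeta>) powr (q - 1) *\<^sub>R h \<zeta>) absolutely_integrable_on {0..s}"
  proof (rule absolutely_integrable_bounded_measurable_product[OF _ _ _ _ kernel,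
        where h = "\<lambda>x r. r *\<^sub>R x"])
    show "bilinear (\<lambda>(x::'a) r::real. r *\<^sub>R x)"
      by (auto simp: bilinear_def linear_iff algebra_simps)
    show "h \<in> borel_measurable (lebesgue_on {0..s})"
      using assms by (intro continuous_imp_measurable_on_sets_lebesgue) auto
    show "bounded (h ` {0..s})"
      using assms by (intro compact_imp_bounded compact_continuous_image) auto
  qed auto
  then show ?thesis
    by (simp add: absolutely_integrable_on_def)
qed

lemma norm_frac_integral_le:
  fixes h :: "real \<Rightarrow> 'a::euclidean_space"
  assumes "q > 0" "s \<ge> 0" "continuous_on {0..s} h" "continuous_on {0..s} \<phi>"
    and le: "\<And>\<zeta>. \<zeta> \<in> {0..s} \<Longrightarrow> norm (h \<zeta>) \<le> \<phi> \<zeta>"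
  shows "norm (frac_integral q h s) \<le> frac_integral q \<phi> s"
proof -
  have "norm (integral {0..s} (\<lambda>\<zeta>. (s - \<zeta>) powr (q - 1) *\<^sub>R h \<zeta>))
      \<le> integral {0..s} (\<lambda>\<zeta>. (s - \<zeta>) powr (q - 1) *\<^sub>R \<phi> \<zeta>)"
    using assms by (intro integral_norm_bound_integral integrable_frac_kernel) (auto intro: mult_left_mono)
  moreover have "Gamma q > 0"
    using assms by (simp add: Gamma_real_pos)
  ultimately show ?thesis
    by (simp add: frac_integral_def field_simps)
qed

lemma frac_integral_diff:
  fixes h k :: "real \<Rightarrow> 'a::euclidean_space"
  assumes "q > 0" "s \<ge> 0" "continuous_on {0..s} h" "continuous_on {0..s} k"
  shows "frac_integral q (\<lambda>\<zeta>. h \<zeta> - k \<zeta>) s = frac_integral q h s - frac_integral q k s"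
  using assms unfolding frac_integral_def
  by (simp add: scaleR_diff_right integral_diff integrable_frac_kernel)

lemma frac_integral_cmult:
  "frac_integral q (\<lambda>\<zeta>. c * \<phi> \<zeta>) s = c * frac_integral q \<phi> s" for c :: real
proof -
  have "integral {0..s} (\<lambda>\<zeta>. (s - \<zeta>) powr (q - 1) * (c * \<phi> \<zeta>))
      = integral {0..s} (\<lambda>\<zeta>. c * ((s - \<zeta>) powr (q - 1) * \<phi> \<zeta>))"
    by (simp add: mult_ac)
  then show ?thesis
    by (simp add: frac_integral_def)
qed

lemma frac_integral_nth:
  fixes h :: "real \<Rightarrow> real ^ 'n"
  assumes "q > 0" "s \<ge> 0" "continuous_on {0..s} h"
  shows "frac_integral q h s $ j = frac_integral q (\<lambda>\<zeta>. h \<zeta> $ j) s"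
  using integral_component_eq_cart[OF integrable_frac_kernel[OF assms], of j]
  by (simp add: frac_integral_def)

text \<open>
  The substitution \<open>t = \<beta> * (s - \<zeta>)\<close> turns the integral into an initial segment of the Gamma
  integral, multiplied by \<open>exp (\<beta> * s) / \<beta> powr q\<close>.
\<close>

lemma frac_integral_exp_le:
  assumes "q > 0" "\<beta> > 0" "s \<ge> 0"
  shows "frac_integral q (\<lambda>\<zeta>. exp (\<beta> * \<zeta>)) s \<le> exp (\<beta> * s) / \<beta> powr q"
proof -
  let ?\<gamma> = "\<lambda>t::real. t powr (q - 1) / exp t"
  note Gamma = Gamma_integral_real[OF \<open>q > 0\<close>]
  have "?\<gamma> integrable_on {0..\<beta> * s}"
    by (rule integrable_on_subinterval[OF has_integral_integrable[OF Gamma]]) auto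
  then have part: "(?\<gamma> has_integral integral {0..\<beta> * s} ?\<gamma>) (cbox 0 (\<beta> * s))"
    by (simp add: integrable_integral)
  have le: "integral {0..\<beta> * s} ?\<gamma> \<le> Gamma q"
    by (rule has_integral_subset_le[OF _ _ Gamma]) (use part in auto)
  have "(\<lambda>x. 1 / - \<beta> * x + - (1 / - \<beta> * (\<beta> * s))) ` {0..\<beta> * s} = {0..s}"
    using assms by (subst image_affinity_atLeastAtMost) (auto simp: field_simps)
  with has_integral_affinity[OF part, of "-\<beta>" "\<beta> * s"] assms
  have "((\<lambda>\<zeta>. ?\<gamma> (\<beta> * s - \<beta> * \<zeta>)) has_integral (integral {0..\<beta> * s} ?\<gamma> / \<beta>)) {0..s}"
    by (simp add: algebra_simps)
  from has_integral_mult_right[OF this, of "exp (\<beta> * s) * \<beta> powr (1 - q)"]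
  have "((\<lambda>\<zeta>. (s - \<zeta>) powr (q - 1) * exp (\<beta> * \<zeta>)) has_integral
      exp (\<beta> * s) * \<beta> powr (1 - q) * (integral {0..\<beta> * s} ?\<gamma> / \<beta>)) {0..s}"
  proof (rule has_integral_eq[rotated])
    fix \<zeta> assume "\<zeta> \<in> {0..s}"
    have "(\<beta> * s - \<beta> * \<zeta>) powr (q - 1) = \<beta> powr (q - 1) * (s - \<zeta>) powr (q - 1)"
      using assms \<open>\<zeta> \<in> _\<close> by (simp add: powr_mult flip: right_diff_distrib)
    moreover have "\<beta> powr (1 - q) * \<beta> powr (q - 1) = 1"
      using assms by (simp flip: powr_add)
    ultimately show "exp (\<beta> * s) * \<beta> powr (1 - q) * ?\<gamma> (\<beta> * s - \<beta> * \<zeta>)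
        = (s - \<zeta>) powr (q - 1) * exp (\<beta> * \<zeta>)"
      by (simp add: exp_diff mult_ac)
  qed
  then have "integral {0..s} (\<lambda>\<zeta>. (s - \<zeta>) powr (q - 1) * exp (\<beta> * \<zeta>))
      = exp (\<beta> * s) * (\<beta> powr (1 - q) / \<beta>) * integral {0..\<beta> * s} ?\<gamma>"
    by (simp add: integral_unique)
  also have "\<beta> powr (1 - q) / \<beta> = 1 / \<beta> powr q"
    using assms by (simp add: powr_diff)
  also have "exp (\<beta> * s) * (1 / \<beta> powr q) * integral {0..\<beta> * s} ?\<gamma>
      \<le> exp (\<beta> * s) * (1 / \<beta> powr q) * Gamma q"
    by (intro mult_left_mono le) auto
  finally show ?thesis
    using Gamma_real_pos[OF \<open>q > 0\<close>] by (simp add: frac_integral_def field_simps)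
qed

text \<open>
  Let \<open>M\<close> be the maximum of \<open>exp (- \<beta> * t) * norm (e t)\<close>. Inserting \<open>norm (e t) \<le> M * exp (\<beta> * t)\<close>
  into the integral equation gives \<open>M \<le> (\<mu> * M + \<epsilon>) / \<beta> powr q\<close>. With \<open>\<beta> powr q = \<mu> + 1\<close> this
  solves to \<open>M \<le> \<epsilon>\<close> without a further constant.
\<close>

lemma fractional_gronwall:
  fixes e d :: "real \<Rightarrow> 'a::euclidean_space"
  assumes "T \<ge> 0" "q > 0" "\<mu> \<ge> 0" "\<epsilon> \<ge> 0"
    and e: "continuous_on {0..T} e" and d: "continuous_on {0..T} d"
    and eq: "\<And>s. s \<in> {0..T} \<Longrightarrow> e s = frac_integral q d s"
    and le: "\<And>s. s \<in> {0..T} \<Longrightarrow> norm (d s) \<le> \<mu> * norm (e s) + \<epsilon>"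
    and s: "s \<in> {0..T}"
  shows "norm (e s) \<le> \<epsilon> * exp ((\<mu> + 1) powr (1 / q) * s)"
proof -
  define \<beta> where "\<beta> = (\<mu> + 1) powr (1 / q)"
  have \<beta>: "\<beta> > 0" "\<beta> powr q = \<mu> + 1"
    using assms by (auto simp: \<beta>_def powr_powr)
  have "\<exists>m\<in>{0..T}. \<forall>t\<in>{0..T}. exp (- (\<beta> * t)) * norm (e t) \<le> exp (- (\<beta> * m)) * norm (e m)"
    using \<open>T \<ge> 0\<close> by (intro continuous_attains_sup continuous_intros e) auto
  then obtain m where m: "m \<in> {0..T}"
    and max: "\<And>t. t \<in> {0..T} \<Longrightarrow> exp (- (\<beta> * t)) * norm (e t) \<le> exp (- (\<beta> * m)) * norm (e m)"
    by blast
  define M where "M = exp (- (\<beta> * m)) * norm (e m)"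
  have M: "norm (e t) \<le> M * exp (\<beta> * t)" if "t \<in> {0..T}" for t
    using max[OF that] by (simp add: M_def exp_minus field_simps)
  have "norm (d t) \<le> (\<mu> * M + \<epsilon>) * exp (\<beta> * t)" if "t \<in> {0..m}" for t
  proof -
    have "norm (d t) \<le> \<mu> * norm (e t) + \<epsilon>"
      using that m by (intro le) auto
    also have "\<dots> \<le> \<mu> * (M * exp (\<beta> * t)) + \<epsilon> * exp (\<beta> * t)"
      using that m assms \<beta> by (intro add_mono mult_left_mono M) (auto simp: mult_le_cancel_left1)
    finally show ?thesis
      by (simp add: algebra_simps)
  qed
  then have "norm (e m) \<le> frac_integral q (\<lambda>t. (\<mu> * M + \<epsilon>) * exp (\<beta> * t)) m"
    unfolding eq[OF m] using m assms
    by (intro norm_frac_integral_le continuous_intros continuous_on_subset[OF d]) auto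
  also have "\<dots> \<le> (\<mu> * M + \<epsilon>) * (exp (\<beta> * m) / \<beta> powr q)"
    unfolding frac_integral_cmult using m assms \<beta>
    by (intro mult_left_mono frac_integral_exp_le) (auto simp: M_def)
  finally have "M \<le> (\<mu> * M + \<epsilon>) / (\<mu> + 1)"
    by (simp add: M_def \<beta> exp_minus field_simps)
  then have "M \<le> \<epsilon>"
    using \<open>\<mu> \<ge> 0\<close> by (simp add: field_simps)
  then show ?thesis
    using order_trans[OF M[OF s] mult_right_mono[of M \<epsilon> "exp (\<beta> * s)"]] by (simp add: \<beta>_def)
qed

section \<open>The Mittag-Leffler function is at least one\<close>

text \<open>
  Restricting the Gamma integral to \<open>{B..B + 1}\<close> shows that the Gamma function grows faster than any
  exponential, which is all that the convergence of the Mittag-Leffler series needs.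
\<close>

lemma Gamma_plus1_ge_powr:
  fixes B x :: real
  assumes "B > 0" "x \<ge> 0"
  shows "Gamma (x + 1) \<ge> B powr x / exp (B + 1)"
proof -
  have "((\<lambda>t. B powr x / exp (B + 1)) has_integral B powr x / exp (B + 1)) {B..B + 1}"
    using has_integral_const_real[of "B powr x / exp (B + 1)" B "B + 1"] by simp
  moreover have "(\<lambda>t. t powr x / exp t) integrable_on {B..B + 1}"
    using assms by (intro integrable_continuous_interval continuous_intros) auto
  then have I: "((\<lambda>t. t powr x / exp t) has_integral integral {B..B+1} (\<lambda>t. t powr x / exp t)) {B..B + 1}"
    by (rule integrable_integral)
  ultimately have "B powr x / exp (B + 1) \<le> integral {B..B+1} (\<lambda>t. t powr x / exp t)"
    by (rule has_integral_le) (use assms in \<open>auto intro!: frac_le powr_mono2\<close>)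
  also have "\<dots> \<le> Gamma (x + 1)"
    using assms Gamma_integral_real[of "x + 1"]
    by (intro has_integral_subset_le[OF _ I, of "{0..}"]) auto
  finally show ?thesis .
qed

lemma summable_mittag_leffler:
  assumes "q > 0" "t \<ge> 0"
  shows "summable (\<lambda>k. t ^ k / Gamma (real k * q + 1))"
proof (rule summable_comparison_test)
  \<comment> \<open>With \<open>B powr q \<ge> 2 * t\<close> the terms are dominated by a geometric series of ratio \<open>1 / 2\<close>; the
    summand \<open>1\<close> keeps \<open>B\<close> positive at \<open>t = 0\<close>.\<close>
  define B where "B = (2 * t + 1) powr (1 / q)"
  have B: "B > 0" "B powr q = 2 * t + 1"
    using assms by (auto simp: B_def powr_powr)
  have "norm (t ^ k / Gamma (real k * q + 1)) \<le> exp (B + 1) * (1 / 2) ^ k" for k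
  proof -
    have "(2 * t) ^ k \<le> (2 * t + 1) ^ k"
      using assms by (intro power_mono) auto
    also have "\<dots> = B powr (real k * q)"
      using B assms powr_powr[of B q "real k"] powr_realpow[of "2 * t + 1" k]
      by (simp add: mult.commute)
    also have "\<dots> \<le> exp (B + 1) * Gamma (real k * q + 1)"
      using Gamma_plus1_ge_powr[OF B(1), of "real k * q"] assms by (simp add: field_simps)
    finally have "t ^ k \<le> exp (B + 1) * (1 / 2) ^ k * Gamma (real k * q + 1)"
      by (simp add: power_mult_distrib field_simps)
    moreover have "Gamma (real k * q + 1) > 0"
      using assms by (intro Gamma_real_pos) (simp add: add_nonneg_pos)
    ultimately show ?thesis
      using assms by (simp add: field_simps)
  qed
  then show "\<exists>N. \<forall>k\<ge>N. norm (t ^ k / Gamma (real k * q + 1)) \<le> exp (B + 1) * (1 / 2) ^ k"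
    by blast
  show "summable (\<lambda>k. exp (B + 1) * (1 / 2) ^ k)"
    by (intro summable_mult summable_geometric) auto
qed

lemma mittag_leffler_ge_1:
  assumes "q > 0" "t \<ge> 0"
  shows "mittag_leffler q t \<ge> 1"
proof -
  have "(\<Sum>k\<in>{0}. t ^ k / Gamma (real k * q + 1)) \<le> mittag_leffler q t"
    unfolding mittag_leffler_def
    using assms by (intro sum_le_suminf summable_mittag_leffler)
      (auto intro!: divide_nonneg_nonneg less_imp_le[OF Gamma_real_pos] add_nonneg_pos)
  then show ?thesis
    by simp
qed


section \<open>Nash equilibria and stability\<close>

lemma convex_K_map:
  assumes "\<And>j. convex (K j (others j v))"
  shows "convex (K_map K v)"
  using assms by (auto simp: convex_def K_map_def)

lemma closed_K_map:
  fixes K :: "'n::finite \<Rightarrow> ('n \<Rightarrow> real) \<Rightarrow> real set"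
  assumes "\<And>j. closed (K j (others j v))"
  shows "closed (K_map K v)"
proof -
  have "K_map K v = (\<Inter>j. (\<lambda>w. w $ j) -` K j (others j v))"
    by (auto simp: K_map_def)
  moreover have "closed ((\<lambda>w. w $ j) -` K j (others j v))" for j
    by (intro closed_vimage assms continuous_intros)
  ultimately show ?thesis
    by auto
qed

text \<open>
  The admissible set \<open>K_map K (u s)\<close> is a product, so the first-order conditions of the individual
  agents add up to a single variational inequality for the pseudo-gradient.
\<close>

lemma nash_equilibrium_variational_inequality:
  fixes K :: "'n::finite \<Rightarrow> ('n \<Rightarrow> real) \<Rightarrow> real set"
  assumes convex: "\<And>j v. convex (K j (others j v))"
    and C1: "\<And>j y v. (\<lambda>w. \<Theta> j y (subst_comp v j w)) C1_differentiable_on UNIV"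
    and nash: "nash_equilibrium T q K \<Theta> f g x0 a x u"
    and s: "s \<in> {0..T}"
  shows "u s \<in> K_map K (u s)"
    and "w \<in> K_map K (u s) \<Longrightarrow> G_map \<Theta> t (x s) (u s) \<bullet> (w - u s) \<ge> 0"
proof -
  have mem: "u s $ j \<in> K j (others j (u s))" for j
    using nash s by (simp add: nash_equilibrium_def)
  then show "u s \<in> K_map K (u s)"
    by (simp add: K_map_def)
  assume w: "w \<in> K_map K (u s)"
  have "G_map \<Theta> t (x s) (u s) $ j * (w $ j - u s $ j) \<ge> 0" for j
  proof (rule real_minimizer_first_order[where S = "K j (others j (u s))"])
    let ?\<phi> = "\<lambda>y. \<Theta> j (x s) (subst_comp (u s) j y)"
    have "?\<phi> differentiable at (u s $ j)"
      using C1[of j "x s" "u s"] by (simp add: C1_differentiable_on_eq)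
    then show "(?\<phi> has_real_derivative G_map \<Theta> t (x s) (u s) $ j) (at (u s $ j))"
      by (simp add: G_map_def DERIV_deriv_iff_real_differentiable)
    have "subst_comp (u s) j (u s $ j) = u s"
      by (simp add: subst_comp_def vec_eq_iff)
    then show "?\<phi> (u s $ j) \<le> ?\<phi> y" if "y \<in> K j (others j (u s))" for y
      using nash s that by (simp add: nash_equilibrium_def)
  qed (use convex mem w in \<open>auto simp: K_map_def\<close>)
  then show "G_map \<Theta> t (x s) (u s) \<bullet> (w - u s) \<ge> 0"
    by (simp add: inner_vec_def sum_nonneg)
qed

text \<open>
  The fractional integral vanishes at time \<open>0\<close>, so the constant nonlocal term is the initial value.
\<close>

lemma nash_equilibrium_state_equation:
  assumes "q > 0" "T \<ge> 0"
    and nash: "nash_equilibrium T q K \<Theta> f g x0 a x u"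
    and cont: "continuous_on {0..T} (\<lambda>\<zeta>. f_vec f \<zeta> (x \<zeta>) + g_vec g \<zeta> (x \<zeta>) (u \<zeta>))"
    and s: "s \<in> {0..T}"
  shows "x s = x 0 + frac_integral q (\<lambda>\<zeta>. f_vec f \<zeta> (x \<zeta>) + g_vec g \<zeta> (x \<zeta>) (u \<zeta>)) s"
proof -
  let ?F = "\<lambda>\<zeta>. f_vec f \<zeta> (x \<zeta>) + g_vec g \<zeta> (x \<zeta>) (u \<zeta>)"
  have "x t $ j = x0 j + a j / T * integral {0..T} (\<lambda>\<zeta>. x \<zeta> $ j) + frac_integral q ?F t $ j"
    if "t \<in> {0..T}" for t j
  proof -
    have "continuous_on {0..t} ?F"
      using that by (intro continuous_on_subset[OF cont]) auto
    then show ?thesis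
      using nash that \<open>q > 0\<close>
      by (simp add: frac_integral_nth nash_equilibrium_def f_vec_def g_vec_def)
  qed
  from this[of s] this[of 0] show ?thesis
    using s \<open>T \<ge> 0\<close> by (simp add: vec_eq_iff frac_integral_def)
qed

text \<open>
  The constant is \<open>exp (\<beta> * T)\<close> with \<open>\<beta> powr q = \<mu> + 1\<close>, where \<open>\<mu>\<close> is a Lipschitz constant of the
  right-hand side in the state once the strategy is slaved to the state with Lipschitz constant \<open>C\<close>.
\<close>

theorem theorem5p3:
  fixes T q :: real
    and K :: "'n::finite \<Rightarrow> ('n \<Rightarrow> real) \<Rightarrow> real set"
    and \<Theta> :: "'n \<Rightarrow> real ^ 'n \<Rightarrow> real ^ 'n \<Rightarrow> real"
    and f :: "'n \<Rightarrow> real \<Rightarrow> real \<Rightarrow> real"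
    and g :: "'n \<Rightarrow> real \<Rightarrow> real \<Rightarrow> real \<Rightarrow> real"
    and x0 a :: "'n \<Rightarrow> real"
    and l_G \<eta>_G l_K l_g l_f :: real
  assumes T: "T > 0"
    and q: "0 < q" "q \<le> 1"
    and K_values: "\<And>j v. K j (others j v) \<noteq> {} \<and> closed (K j (others j v)) \<and> convex (K j (others j v))"
    and \<Theta>_convex: "\<And>j y v. convex_on UNIV (\<lambda>w. \<Theta> j y (subst_comp v j w))"
    and \<Theta>_C1: "\<And>j y v. (\<lambda>w. \<Theta> j y (subst_comp v j w)) C1_differentiable_on UNIV"
    and constants: "l_G > 0" "\<eta>_G > 0" "l_K \<ge> 0" "l_g > 0" "l_f > 0"
    and G_lipschitz: "\<And>s1 s2 x1 x2 u1 u2. s1 \<in> {0..T} \<Longrightarrow> s2 \<in> {0..T} \<Longrightarrow>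
      norm (G_map \<Theta> s2 x2 u2 - G_map \<Theta> s1 x1 u1)
        \<le> l_G * (\<bar>s2 - s1\<bar> + norm (x2 - x1) + norm (u2 - u1))"
    and G_pseudomonotone: "\<And>s x u u1 u2. s \<in> {0..T} \<Longrightarrow> u1 \<in> K_map K u \<Longrightarrow> u2 \<in> K_map K u \<Longrightarrow>
      G_map \<Theta> s x u2 \<bullet> (u1 - u2) \<ge> 0 \<Longrightarrow>
      G_map \<Theta> s x u1 \<bullet> (u1 - u2) \<ge> \<eta>_G * (norm (u1 - u2))\<^sup>2"
    and K_lipschitz: "\<And>u1 u2 p.
      norm (closest_point (K_map K u2) p - closest_point (K_map K u1) p) \<le> l_K * norm (u2 - u1)"
    and g_continuous: "continuous_on ({0..T} \<times> UNIV \<times> UNIV) (\<lambda>(s, y, v). g_vec g s y v)"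
    and g_lipschitz: "\<And>s x1 x2 u1 u2. s \<in> {0..T} \<Longrightarrow>
      norm (g_vec g s x2 u2 - g_vec g s x1 u1) \<le> l_g * (norm (x2 - x1) + norm (u2 - u1))"
    and f_continuous: "continuous_on ({0..T} \<times> UNIV) (\<lambda>(s, y). f_vec f s y)"
    and f_lipschitz: "\<And>s x1 x2. s \<in> {0..T} \<Longrightarrow>
      norm (f_vec f s x2 - f_vec f s x1) \<le> l_f * norm (x2 - x1)"
    and contraction: "2 * (l_K\<^sup>2 / \<eta>_G\<^sup>2) *
      (l_G * sqrt (4 * l_G\<^sup>2 + 2 * \<eta>_G\<^sup>2) + 2 * l_G\<^sup>2 + \<eta>_G\<^sup>2) < 1"
    and a_bound: "0 < Max (range (\<lambda>j. \<bar>a j\<bar>))" "Max (range (\<lambda>j. \<bar>a j\<bar>)) < 1"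
  shows "\<exists>c>0. \<forall>\<epsilon>>0. \<forall>x u z \<upsilon>.
    nash_equilibrium T q K \<Theta> f g x0 a x u \<longrightarrow>
    perturbed_solution T q K \<Theta> f g \<epsilon> z \<upsilon> \<longrightarrow> z 0 = x 0 \<longrightarrow>
    (\<forall>s\<in>{0..T}. norm (z s - x s) \<le> c * \<epsilon> * mittag_leffler q s)"
proof -
  define C where "C = l_G / \<eta>_G / (1 - l_K * (sqrt 2 + l_G / \<eta>_G))"
  define \<mu> where "\<mu> = l_f + l_g * (1 + C)"
  have small: "l_K * (sqrt 2 + l_G / \<eta>_G) < 1"
    using quasi_variational_constant_less_1 constants(1-3) contraction .
  then have "C > 0"
    using constants by (simp add: C_def)
  then have "\<mu> > 0"
    using constants by (simp add: \<mu>_def add_pos_pos)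
  have K_closed: "closed (K_map K v)" and K_convex: "convex (K_map K v)" for v
    using K_values by (auto intro!: closed_K_map convex_K_map)
  have f_comp: "continuous_on {0..T} (\<lambda>\<zeta>. f_vec f \<zeta> (y \<zeta>))"
    if "continuous_on {0..T} y" for y
  proof -
    have "continuous_on {0..T} (\<lambda>\<zeta>. (\<lambda>(s, y). f_vec f s y) (\<zeta>, y \<zeta>))"
      by (rule continuous_on_compose2[OF f_continuous]) (use that in \<open>auto intro!: continuous_intros\<close>)
    then show ?thesis
      by simp
  qed
  have g_comp: "continuous_on {0..T} (\<lambda>\<zeta>. g_vec g \<zeta> (y \<zeta>) (w \<zeta>))"
    if "continuous_on {0..T} y" "continuous_on {0..T} w" for y w
  proof -
    have "continuous_on {0..T} (\<lambda>\<zeta>. (\<lambda>(s, y, v). g_vec g s y v) (\<zeta>, y \<zeta>, w \<zeta>))"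
      by (rule continuous_on_compose2[OF g_continuous]) (use that in \<open>auto intro!: continuous_intros\<close>)
    then show ?thesis
      by simp
  qed
  have "norm (z s - x s) \<le> exp (((\<mu> + 1) powr (1 / q)) * T) * \<epsilon> * mittag_leffler q s"
    if "\<epsilon> > 0" and nash: "nash_equilibrium T q K \<Theta> f g x0 a x u"
      and perturbed: "perturbed_solution T q K \<Theta> f g \<epsilon> z \<upsilon>"
      and init: "z 0 = x 0" and s: "s \<in> {0..T}"
    for \<epsilon> x u z \<upsilon> s
  proof -
    have cont: "continuous_on {0..T} x" "continuous_on {0..T} u"
        "continuous_on {0..T} z" "continuous_on {0..T} \<upsilon>"
      using nash perturbed by (auto simp: nash_equilibrium_def perturbed_solution_def)
    obtain h where h: "continuous_on {0..T} h" "\<And>t. t \<in> {0..T} \<Longrightarrow> norm (h t) \<le> \<epsilon>"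
      and z_eq: "\<And>t. t \<in> {0..T} \<Longrightarrow> z t = z 0 +
        frac_integral q (\<lambda>\<zeta>. f_vec f \<zeta> (z \<zeta>) + g_vec g \<zeta> (z \<zeta>) (\<upsilon> \<zeta>) + h \<zeta>) t"
      using perturbed unfolding perturbed_solution_def by blast
    let ?X = "\<lambda>\<zeta>. f_vec f \<zeta> (x \<zeta>) + g_vec g \<zeta> (x \<zeta>) (u \<zeta>)"
    let ?Z = "\<lambda>\<zeta>. f_vec f \<zeta> (z \<zeta>) + g_vec g \<zeta> (z \<zeta>) (\<upsilon> \<zeta>) + h \<zeta>"
    have X: "continuous_on {0..T} ?X" and Z: "continuous_on {0..T} ?Z"
      by (intro continuous_on_add f_comp g_comp cont h(1))+
    have strategies: "norm (\<upsilon> t - u t) \<le> C * norm (z t - x t)" if t: "t \<in> {0..T}" for t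
      unfolding C_def
    proof (rule quasi_variational_dependence[where S = "K_map K" and G = "G_map \<Theta> t"])
      show "norm (G_map \<Theta> t x2 u2 - G_map \<Theta> t x1 u1) \<le> l_G * (norm (x2 - x1) + norm (u2 - u1))"
        for x1 x2 u1 u2
        using G_lipschitz[OF t t, of x2 u2 x1 u1] by simp
      show "u t \<in> K_map K (u t)"
        and "\<And>w. w \<in> K_map K (u t) \<Longrightarrow> G_map \<Theta> t (x t) (u t) \<bullet> (w - u t) \<ge> 0"
        using nash_equilibrium_variational_inequality[OF _ \<Theta>_C1 nash t] K_values by auto
      show "\<upsilon> t \<in> K_map K (\<upsilon> t)"
        and "\<And>w. w \<in> K_map K (\<upsilon> t) \<Longrightarrow> G_map \<Theta> t (z t) (\<upsilon> t) \<bullet> (w - \<upsilon> t) \<ge> 0"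
        using perturbed t by (auto simp: perturbed_solution_def)
    qed (use constants K_closed K_convex K_lipschitz G_pseudomonotone t small in auto)
    have "norm (z s - x s) \<le> \<epsilon> * exp ((\<mu> + 1) powr (1 / q) * s)"
    proof (rule fractional_gronwall[where T = T and d = "\<lambda>t. ?Z t - ?X t"])
      show "z t - x t = frac_integral q (\<lambda>t. ?Z t - ?X t) t" if t: "t \<in> {0..T}" for t
      proof -
        have sub: "{0..t} \<subseteq> {0..T}"
          using t by auto
        have "frac_integral q (\<lambda>t. ?Z t - ?X t) t = frac_integral q ?Z t - frac_integral q ?X t"
          using q t by (intro frac_integral_diff continuous_on_subset[OF _ sub] X Z) auto
        moreover have "z t = z 0 + frac_integral q ?Z t"
          by (rule z_eq[OF t])
        moreover have "x t = x 0 + frac_integral q ?X t"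
          using q T t X by (intro nash_equilibrium_state_equation[OF _ _ nash]) auto
        ultimately show ?thesis
          by (simp only: init add_diff_cancel_left)
      qed
      show "norm (?Z t - ?X t) \<le> \<mu> * norm (z t - x t) + \<epsilon>" if t: "t \<in> {0..T}" for t
      proof -
        have "?Z t - ?X t = (f_vec f t (z t) - f_vec f t (x t))
            + (g_vec g t (z t) (\<upsilon> t) - g_vec g t (x t) (u t)) + h t"
          by (simp add: algebra_simps)
        also have "norm \<dots> \<le> l_f * norm (z t - x t)
            + l_g * (norm (z t - x t) + norm (\<upsilon> t - u t)) + \<epsilon>"
          by (intro order_trans[OF norm_triangle_ineq] add_mono f_lipschitz g_lipschitz h(2) t)
        also have "\<dots> \<le> l_f * norm (z t - x t)
            + l_g * (norm (z t - x t) + C * norm (z t - x t)) + \<epsilon>"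
          using constants by (intro add_mono mult_left_mono strategies t) auto
        finally show ?thesis
          by (simp add: \<mu>_def algebra_simps)
      qed
    qed (use T q \<open>\<mu> > 0\<close> \<open>\<epsilon> > 0\<close> cont X Z s in \<open>auto intro!: continuous_on_diff\<close>)
    also have "\<dots> \<le> \<epsilon> * exp ((\<mu> + 1) powr (1 / q) * T)"
      using s \<open>\<epsilon> > 0\<close> by (auto intro: mult_left_mono)
    also have "\<dots> \<le> \<epsilon> * exp ((\<mu> + 1) powr (1 / q) * T) * mittag_leffler q s"
      using mittag_leffler_ge_1[of q s] q s \<open>\<epsilon> > 0\<close> by simp
    finally show ?thesis
      by (simp add: mult_ac)
  qed
  then show ?thesis
    by (intro exI[of _ "exp (((\<mu> + 1) powr (1 / q)) * T)"]) auto
qed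

end
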